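(* Let $A$ be a 3-Lie algebra over a field of characteristic different from $2$, with a basis $\{e_1,\dots,e_n\}$ and ternary operation given by $[e_i,e_j,e_k]=\sum_{m}T_{ijk}^{m}e_m$. Suppose that $r=\sum_{i,j}a^{ij}e_i\otimes e_j\in A\otimes A$ is skew-symmetric, i.e. $a^{ij}=-a^{ji}$ for all $i,j$. Then $$[[r,r,r]]=\sum_{p<q<s}\ \sum_{i<j<k}\ \sum_{l} D^{ijk}_{pqs}\,T_{ijk}^{l}\; e_l\wedge e_p\wedge e_q\wedge e_s,$$ where for all $i_1,i_2,i_3,p,q,s\in\{1,\dots,n\}$ $$D^{i_1i_2i_3}_{pqs}:=\sum_{\sigma\in S_3}\mathrm{sgn}(\sigma)\,a^{i_{\sigma(1)}p}a^{i_{\sigma(2)}q}a^{i_{\sigma(3)}s}.$$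
   Context: A 3-Lie algebra is a vector space $A$ with a trilinear, totally skew-symmetric bracket $[\cdot,\cdot,\cdot]:\otimes^3A\to A$ such that for all $x_1,\dots,x_5\in A$: $[x_1,x_2,[x_3,x_4,x_5]]=[[x_1,x_2,x_3],x_4,x_5]+[x_3,[x_1,x_2,x_4],x_5]+[x_3,x_4,[x_1,x_2,x_5]]$. For $r=\sum_i x_i\otimes y_i\in A\otimes A$, the element $[[r,r,r]]\in\otimes^4A$ is $$[[r,r,r]]=\sum_{i,j,k}\big([x_i,x_j,x_k]\otimes y_i\otimes y_j\otimes y_k+x_i\otimes[y_i,x_j,x_k]\otimes y_j\otimes y_k+x_i\otimes x_j\otimes[y_i,y_j,x_k]\otimes y_k+x_i\otimes x_j\otimes x_k\otimes[y_i,y_j,y_k]\big).$$ The wedge product denotes the antisymmetrized tensor without normalization: $v_1\wedge\cdots\wedge v_m=\sum_{\sigma\in S_m}\mathrm{sgn}(\sigma)\,v_{\sigma(1)}\otimes\cdots\otimes v_{\sigma(m)}\in V^{\otimes m}$. All summation indices range over $\{1,\dots,n\}$. *)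

theory Defs
  imports
    Complex_Main
    "HOL-Library.Poly_Mapping"
    "HOL-Combinatorics.Permutations"
begin

text \<open>
  All vector spaces are types with an explicit scalar multiplication, as in the library locale
  \<^locale>\<open>vector_space\<close>.
\<close>

locale three_lie_algebra = vector_space scale
  for scale :: "'k::field \<Rightarrow> 'v::ab_group_add \<Rightarrow> 'v" +
  fixes br :: "'v \<Rightarrow> 'v \<Rightarrow> 'v \<Rightarrow> 'v"
  assumes linear_1: "Vector_Spaces.linear scale scale (\<lambda>x. br x y z)"
    and linear_2: "Vector_Spaces.linear scale scale (\<lambda>y. br x y z)"
    and linear_3: "Vector_Spaces.linear scale scale (\<lambda>z. br x y z)"
    and skew_12: "br y x z = - br x y z"
    and skew_23: "br x z y = - br x y z"
    and skew_13: "br z y x = - br x y z"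
    and fundamental_identity:
      "br x1 x2 (br x3 x4 x5) =
         br (br x1 x2 x3) x4 x5 + br x3 (br x1 x2 x4) x5 + br x3 x4 (br x1 x2 x5)"


text \<open>
  The m-th tensor power of V is the free vector space on words over V modulo the subspace
  spanned by the multilinearity relations between words of length m. Its elements
  are cosets of this subspace. The free space contains words of every length; since the relations
  for m only involve words of length m, two formal combinations of words of length m lie in the
  same coset exactly if they are equal in the usual m-th tensor power. Linear combinations are
  formed in the free space, before passing to cosets.
\<close>

definition formal_scale :: "'k::field \<Rightarrow> ('w \<Rightarrow>\<^sub>0 'k) \<Rightarrow> ('w \<Rightarrow>\<^sub>0 'k)"
  where "formal_scale c f = Poly_Mapping.map ((*) c) f"

lemma lookup_formal_scale [simp]: "Poly_Mapping.lookup (formal_scale c f) w = c * Poly_Mapping.lookup f w"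
  by (simp add: formal_scale_def Poly_Mapping.map.rep_eq when_def)

lemma vector_space_formal_scale: "vector_space formal_scale"
  by unfold_locales
    (auto intro!: poly_mapping_eqI simp: lookup_add algebra_simps)

definition word :: "'v list \<Rightarrow> ('v list \<Rightarrow>\<^sub>0 'k::field)"
  where "word vs = Poly_Mapping.single vs 1"

definition multilinear_relations ::
    "('k::field \<Rightarrow> 'v::ab_group_add \<Rightarrow> 'v) \<Rightarrow> nat \<Rightarrow> ('v list \<Rightarrow>\<^sub>0 'k) set"
  where "multilinear_relations scale m =
    {word (us @ [x + y] @ ws) - (word (us @ [x] @ ws) + word (us @ [y] @ ws)) | us x y ws.
       length (us @ [x] @ ws) = m} \<union>
    {word (us @ [scale c x] @ ws) - formal_scale c (word (us @ [x] @ ws)) | us c x ws.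
       length (us @ [x] @ ws) = m}"

definition relation_space ::
    "('k::field \<Rightarrow> 'v::ab_group_add \<Rightarrow> 'v) \<Rightarrow> nat \<Rightarrow> ('v list \<Rightarrow>\<^sub>0 'k) set"
  where "relation_space scale m = module.span formal_scale (multilinear_relations scale m)"

definition tensor ::
    "('k::field \<Rightarrow> 'v::ab_group_add \<Rightarrow> 'v) \<Rightarrow> nat \<Rightarrow> ('v list \<Rightarrow>\<^sub>0 'k) \<Rightarrow> ('v list \<Rightarrow>\<^sub>0 'k) set"
  where "tensor scale m f = {g. g - f \<in> relation_space scale m}"

lemma tensor_eq_iff:
  fixes scale :: "'k::field \<Rightarrow> 'v::ab_group_add \<Rightarrow> 'v"
  shows "tensor scale m f = tensor scale m g \<longleftrightarrow> f - g \<in> relation_space scale m"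
proof -
  interpret F: vector_space "formal_scale :: 'k \<Rightarrow> ('v list \<Rightarrow>\<^sub>0 'k) \<Rightarrow> _"
    by (rule vector_space_formal_scale)
  let ?R = "relation_space scale m"
  have add: "x + y \<in> ?R" and diff: "x - y \<in> ?R"
    if "x \<in> ?R" "y \<in> ?R" for x y
    using that unfolding relation_space_def by (auto intro: F.span_add F.span_diff)
  have zero: "0 \<in> ?R"
    unfolding relation_space_def by (rule F.span_zero)
  show ?thesis
  proof
    assume "tensor scale m f = tensor scale m g"
    moreover have "f \<in> tensor scale m f"
      using zero by (simp add: tensor_def)
    ultimately show "f - g \<in> ?R"
      by (simp add: tensor_def)
  next
    assume fg: "f - g \<in> ?R"
    have "h - f \<in> ?R \<longleftrightarrow> h - g \<in> ?R" for h
      using add[OF _ fg, of "h - f"] diff[OF _ fg, of "h - g"] by auto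
    then show "tensor scale m f = tensor scale m g"
      by (auto simp: tensor_def)
  qed
qed


definition wedge :: "'v list \<Rightarrow> ('v list \<Rightarrow>\<^sub>0 'k::field)"
  where "wedge vs =
    (\<Sum>\<sigma> | \<sigma> permutes {..<length vs}. formal_scale (of_int (sign \<sigma>)) (word (permute_list \<sigma> vs)))"

text \<open>The list \<open>ps\<close> of pairs \<open>(x\<^sub>i, y\<^sub>i)\<close> represents the sum of all \<open>x\<^sub>i \<otimes> y\<^sub>i\<close>.\<close>

definition sum_of_pairs :: "('v \<times> 'v) list \<Rightarrow> ('v list \<Rightarrow>\<^sub>0 'k::field)"
  where "sum_of_pairs ps = (\<Sum>i<length ps. word [fst (ps ! i), snd (ps ! i)])"

definition rrr_of_pairs ::
    "('v \<Rightarrow> 'v \<Rightarrow> 'v \<Rightarrow> 'v) \<Rightarrow> ('v \<times> 'v) list \<Rightarrow> ('v list \<Rightarrow>\<^sub>0 'k::field)"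
  where "rrr_of_pairs br ps =
    (let N = length ps; x = (\<lambda>i. fst (ps ! i)); y = (\<lambda>i. snd (ps ! i)) in
     \<Sum>i<N. \<Sum>j<N. \<Sum>k<N.
         word [br (x i) (x j) (x k), y i, y j, y k]
       + word [x i, br (y i) (x j) (x k), y j, y k]
       + word [x i, x j, br (y i) (y j) (x k), y k]
       + word [x i, x j, x k, br (y i) (y j) (y k)])"

text \<open>
  The union ranges over all representations of the element \<open>r\<close> of the second tensor power as a sum
  of \<open>x\<^sub>i \<otimes> y\<^sub>i\<close>. As all of them give the same coset, the union is that
  coset; a union of several distinct cosets would not be an element of the fourth tensor power.
\<close>

definition rrr ::
    "('k::field \<Rightarrow> 'v::ab_group_add \<Rightarrow> 'v) \<Rightarrow> ('v \<Rightarrow> 'v \<Rightarrow> 'v \<Rightarrow> 'v) \<Rightarrow>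
     ('v list \<Rightarrow>\<^sub>0 'k) set \<Rightarrow> ('v list \<Rightarrow>\<^sub>0 'k) set"
  where "rrr scale br r =
    (\<Union>ps \<in> {ps. tensor scale 2 (sum_of_pairs ps) = r}. tensor scale 4 (rrr_of_pairs br ps))"

definition D_coeff ::
    "(nat \<Rightarrow> nat \<Rightarrow> 'k::field) \<Rightarrow> nat \<Rightarrow> nat \<Rightarrow> nat \<Rightarrow> nat \<Rightarrow> nat \<Rightarrow> nat \<Rightarrow> 'k"
  where "D_coeff a i\<^sub>1 i\<^sub>2 i\<^sub>3 p q s =
    (\<Sum>\<sigma> | \<sigma> permutes {..<3}. of_int (sign \<sigma>) *
       (a ([i\<^sub>1, i\<^sub>2, i\<^sub>3] ! \<sigma> 0) p * a ([i\<^sub>1, i\<^sub>2, i\<^sub>3] ! \<sigma> 1) q * a ([i\<^sub>1, i\<^sub>2, i\<^sub>3] ! \<sigma> 2) s))"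

end

theory Submission
  imports Defs
begin

text \<open>
  A tensor is determined by its coordinates, and the matrix \<open>a\<close> of \<open>r\<close> can be read off from
  every representation of \<open>r\<close> as a sum of pairs, so \<open>[[r,r,r]]\<close> depends only on \<open>a\<close>. Put
  \<open>G l p q s = \<Sum>\<^bsub>i,j,k\<^esub> a i p * a j q * a k s * T i j k l\<close>. As \<open>T\<close> is alternating in \<open>i, j, k\<close>
  (here the characteristic enters), collecting the permutations of each \<open>i < j < k\<close> turns this
  into \<open>\<Sum>\<^bsub>i<j<k\<^esub> D * T\<close>; hence \<open>G\<close> is alternating in \<open>p, q, s\<close>, as \<open>D\<close> is a determinant.
  Expanding the wedge product along the position of \<open>e\<^sub>l\<close>, both sides have the coordinate
  \<open>G \<alpha> \<beta> \<gamma> \<delta> - G \<beta> \<alpha> \<gamma> \<delta> + G \<gamma> \<alpha> \<beta> \<delta> - G \<delta> \<alpha> \<beta> \<gamma>\<close> at \<open>(\<alpha>, \<beta>, \<gamma>, \<delta>)\<close>; on the left, the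
  signs come from moving \<open>a\<close>'s transposed arguments into place by skew-symmetry.
\<close>

section \<open>Formal combinations of words and their coordinate functionals\<close>

definition homogeneous :: "nat \<Rightarrow> ('v list \<Rightarrow>\<^sub>0 'k::field) set"
  where "homogeneous m = {f. \<forall>w\<in>Poly_Mapping.keys f. length w = m}"

lemma homogeneous_iff: "f \<in> homogeneous m \<longleftrightarrow> (\<forall>w. Poly_Mapping.lookup f w \<noteq> 0 \<longrightarrow> length w = m)"
  by (auto simp: homogeneous_def in_keys_iff)

lemma homogeneous_0 [simp]: "0 \<in> homogeneous m"
  by (simp add: homogeneous_iff)

lemma homogeneous_add [intro]: "f \<in> homogeneous m \<Longrightarrow> g \<in> homogeneous m \<Longrightarrow> f + g \<in> homogeneous m"
  unfolding homogeneous_iff lookup_add by (metis add.right_neutral)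

lemma homogeneous_diff: "f \<in> homogeneous m \<Longrightarrow> g \<in> homogeneous m \<Longrightarrow> f - g \<in> homogeneous m"
  unfolding homogeneous_iff lookup_minus by (metis diff_zero)

lemma homogeneous_formal_scale [intro]: "f \<in> homogeneous m \<Longrightarrow> formal_scale c f \<in> homogeneous m"
  by (auto simp: homogeneous_iff)

lemma homogeneous_word [intro]: "length w = m \<Longrightarrow> word w \<in> homogeneous m"
  by (auto simp: homogeneous_iff word_def lookup_single when_def)

lemma homogeneous_sum [intro]: "(\<And>x. x \<in> A \<Longrightarrow> f x \<in> homogeneous m) \<Longrightarrow> sum f A \<in> homogeneous m"
  by (induction A rule: infinite_finite_induct) auto

lemma homogeneous_wedge [intro]: "length vs = m \<Longrightarrow> wedge vs \<in> homogeneous m"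
  unfolding wedge_def
  by (intro homogeneous_sum homogeneous_formal_scale homogeneous_word) simp

lemma eq_sum_words: "f = (\<Sum>w\<in>Poly_Mapping.keys f. formal_scale (Poly_Mapping.lookup f w) (word w))"
  by (rule poly_mapping_eqI)
    (simp add: lookup_sum word_def lookup_single when_def in_keys_iff if_distrib[of "\<lambda>x. _ * x"] cong: if_cong)

text \<open>When the \<open>c i\<close> are linear forms, this is multilinear in the letters; for a
  dual basis it is a coordinate of the pure tensor. The zip truncates, so only lists of equal length
  are meaningful.\<close>

definition word_coeff :: "('i \<Rightarrow> 'v \<Rightarrow> 'k::field) \<Rightarrow> 'i list \<Rightarrow> 'v list \<Rightarrow> 'k"
  where "word_coeff c is w = prod_list (map2 c is w)"

definition coeff :: "('i \<Rightarrow> 'v \<Rightarrow> 'k::field) \<Rightarrow> 'i list \<Rightarrow> ('v list \<Rightarrow>\<^sub>0 'k) \<Rightarrow> 'k"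
  where "coeff c is f = (\<Sum>w\<in>Poly_Mapping.keys f. Poly_Mapping.lookup f w * word_coeff c is w)"

lemma word_coeff_simps [simp]:
  "word_coeff c [] w = 1" "word_coeff c is [] = 1"
  "word_coeff c (i # is) (x # w) = c i x * word_coeff c is w"
  by (simp_all add: word_coeff_def)

text \<open>Terms may cancel, so \<open>f\<close>, \<open>g\<close> and \<open>f + g\<close> can
  have different keys; additivity of \<open>coeff\<close> needs one common index set.\<close>

lemma coeff_superset:
  assumes "finite W" "Poly_Mapping.keys f \<subseteq> W"
  shows "coeff c is f = (\<Sum>w\<in>W. Poly_Mapping.lookup f w * word_coeff c is w)"
  unfolding coeff_def by (rule sum.mono_neutral_left) (use assms in \<open>auto simp: in_keys_iff\<close>)

lemma coeff_0 [simp]: "coeff c is 0 = 0"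
  by (simp add: coeff_def)

lemma coeff_add [simp]: "coeff c is (f + g) = coeff c is f + coeff c is g"
proof -
  let ?W = "Poly_Mapping.keys f \<union> Poly_Mapping.keys g"
  have "coeff c is h = (\<Sum>w\<in>?W. Poly_Mapping.lookup h w * word_coeff c is w)" if "Poly_Mapping.keys h \<subseteq> ?W" for h
    by (rule coeff_superset) (use that in auto)
  from this[of "f + g"] this[of f] this[of g] show ?thesis
    using keys_add[of f g] by (simp add: lookup_add distrib_right sum.distrib)
qed

lemma coeff_formal_scale [simp]: "coeff c is (formal_scale b f) = b * coeff c is f"
proof -
  have "coeff c is (formal_scale b f) =
      (\<Sum>w\<in>Poly_Mapping.keys f. Poly_Mapping.lookup (formal_scale b f) w * word_coeff c is w)"
    by (rule coeff_superset) (auto simp: in_keys_iff)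
  then show ?thesis
    by (simp add: coeff_def sum_distrib_left mult.assoc)
qed

lemma coeff_word [simp]: "coeff c is (word w) = word_coeff c is w"
  by (simp add: coeff_def word_def)

lemma coeff_diff [simp]: "coeff c is (f - g) = coeff c is f - coeff c is g"
  using coeff_add[of c "is" "f - g" g] by simp

lemma coeff_sum [simp]: "coeff c is (sum f A) = (\<Sum>x\<in>A. coeff c is (f x))"
  by (induction A rule: infinite_finite_induct) simp_all

text \<open>Isolating the factor of one letter reduces compatibility with the multilinearity
  relations to the linearity of \<open>c\<close> in that letter.\<close>

lemma word_coeff_append:
  assumes "length is = length (us @ [x] @ ws)"
  shows "word_coeff c is (us @ [x] @ ws) =
    word_coeff c (take (length us) is) us * c (is ! length us) x *
    word_coeff c (drop (Suc (length us)) is) ws"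
proof -
  have "drop (length us) is = is ! length us # drop (Suc (length us)) is"
    using assms by (simp add: Cons_nth_drop_Suc)
  then show ?thesis
    by (simp add: word_coeff_def zip_append2 mult.assoc)
qed

section \<open>Congruence modulo the multilinearity relations\<close>

interpretation formal: vector_space "formal_scale :: 'k::field \<Rightarrow> ('w \<Rightarrow>\<^sub>0 'k) \<Rightarrow> _"
  by (rule vector_space_formal_scale)

text \<open>Equivalent to equality of cosets by \<open>tensor_eq_iff\<close>; as a relation on
  formal combinations it can be chained and passed through sums and scalars.\<close>

definition tensor_cong ::
    "('k::field \<Rightarrow> 'v::ab_group_add \<Rightarrow> 'v) \<Rightarrow> nat \<Rightarrow> ('v list \<Rightarrow>\<^sub>0 'k) \<Rightarrow> ('v list \<Rightarrow>\<^sub>0 'k) \<Rightarrow> bool"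
  where "tensor_cong scale m f g \<longleftrightarrow> f - g \<in> relation_space scale m"

lemma tensor_cong_refl [simp]: "tensor_cong scale m f f"
  by (simp add: tensor_cong_def relation_space_def formal.span_zero)

lemma tensor_cong_trans [trans]:
  "tensor_cong scale m f g \<Longrightarrow> tensor_cong scale m g h \<Longrightarrow> tensor_cong scale m f h"
  unfolding tensor_cong_def relation_space_def by (drule (1) formal.span_add) simp

lemma tensor_cong_add:
  "tensor_cong scale m f g \<Longrightarrow> tensor_cong scale m f' g' \<Longrightarrow> tensor_cong scale m (f + f') (g + g')"
  unfolding tensor_cong_def relation_space_def by (drule (1) formal.span_add) (simp add: algebra_simps)

lemma tensor_cong_scale:
  "tensor_cong scale m f g \<Longrightarrow> tensor_cong scale m (formal_scale c f) (formal_scale c g)"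
  unfolding tensor_cong_def relation_space_def
  by (drule formal.span_scale[of _ _ c]) (simp add: formal.scale_right_diff_distrib)

lemma tensor_cong_sum:
  "(\<And>x. x \<in> A \<Longrightarrow> tensor_cong scale m (f x) (g x)) \<Longrightarrow> tensor_cong scale m (sum f A) (sum g A)"
  by (induction A rule: infinite_finite_induct) (auto intro: tensor_cong_add)

lemma tensor_cong_word_add:
  "length (us @ [x] @ ws) = m \<Longrightarrow>
    tensor_cong scale m (word (us @ [x + y] @ ws)) (word (us @ [x] @ ws) + word (us @ [y] @ ws))"
  unfolding tensor_cong_def relation_space_def multilinear_relations_def
  by (rule formal.span_base) blast

lemma tensor_cong_word_scale:
  "length (us @ [x] @ ws) = m \<Longrightarrow>
    tensor_cong scale m (word (us @ [scale c x] @ ws)) (formal_scale c (word (us @ [x] @ ws)))"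
  unfolding tensor_cong_def relation_space_def multilinear_relations_def
  by (rule formal.span_base) blast

lemma (in vector_space) tensor_cong_word_sum:
  assumes "finite I" "length us + length ws + 1 = m"
  shows "tensor_cong scale m (word (us @ [\<Sum>i\<in>I. scale (b i) (x i)] @ ws))
    (\<Sum>i\<in>I. formal_scale (b i) (word (us @ [x i] @ ws)))"
  using assms(1)
proof (induction I rule: finite_induct)
  case empty
  \<comment> \<open>The empty sum is the letter 0; writing it as \<open>scale 0 0\<close> lets a
    scaling relation turn the word into 0.\<close>
  have "tensor_cong scale m (word (us @ [scale 0 0] @ ws)) (formal_scale 0 (word (us @ [0] @ ws)))"
    by (rule tensor_cong_word_scale) (use assms in simp)
  then show ?case by simp
next
  case (insert j I)
  have "tensor_cong scale m (word (us @ [scale (b j) (x j) + (\<Sum>i\<in>I. scale (b i) (x i))] @ ws))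
    (word (us @ [scale (b j) (x j)] @ ws) + word (us @ [\<Sum>i\<in>I. scale (b i) (x i)] @ ws))"
    by (rule tensor_cong_word_add) (use assms in simp)
  also have "tensor_cong scale m \<dots> (formal_scale (b j) (word (us @ [x j] @ ws)) +
      (\<Sum>i\<in>I. formal_scale (b i) (word (us @ [x i] @ ws))))"
    by (rule tensor_cong_add[OF tensor_cong_word_scale insert.IH]) (use assms in simp)
  finally show ?case using insert.hyps by simp
qed

section \<open>Tensor coordinates with respect to a finite basis\<close>

locale indexed_basis = vector_space scale
  for scale :: "'k::field \<Rightarrow> 'v::ab_group_add \<Rightarrow> 'v" +
  fixes I :: "'i set" and e :: "'i \<Rightarrow> 'v"
  assumes finite_index: "finite I"
    and inj_basis: "inj_on e I"
    and indep_basis: "independent (e ` I)"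
    and span_basis: "span (e ` I) = UNIV"
begin

definition coord :: "'i \<Rightarrow> 'v \<Rightarrow> 'k"
  where "coord i x = representation (e ` I) x (e i)"

lemma coord_add [simp]: "coord i (x + y) = coord i x + coord i y"
  by (simp add: coord_def representation_add indep_basis span_basis)

lemma coord_scale [simp]: "coord i (scale b x) = b * coord i x"
  by (simp add: coord_def representation_scale indep_basis span_basis)

lemma coord_0 [simp]: "coord i 0 = 0"
  by (simp add: coord_def representation_zero)

lemma coord_uminus [simp]: "coord i (- x) = - coord i x"
  by (simp add: coord_def representation_neg indep_basis span_basis)

lemma coord_sum [simp]: "coord i (sum f A) = (\<Sum>x\<in>A. coord i (f x))"
  by (induction A rule: infinite_finite_induct) simp_all

lemma coord_basis: "i \<in> I \<Longrightarrow> j \<in> I \<Longrightarrow> coord i (e j) = (if i = j then 1 else 0)"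
  using inj_basis by (auto simp: coord_def representation_basis indep_basis inj_on_eq_iff)

lemma sum_coord: "(\<Sum>i\<in>I. scale (coord i x) (e i)) = x"
proof -
  have "(\<Sum>b\<in>e ` I. scale (representation (e ` I) x b) b) = x"
    by (rule sum_representation_eq) (simp_all add: indep_basis span_basis finite_index)
  then show ?thesis
    by (simp add: coord_def sum.reindex inj_basis)
qed

abbreviation index_lists :: "nat \<Rightarrow> 'i list set"
  where "index_lists m \<equiv> {is. set is \<subseteq> I \<and> length is = m}"

lemma index_lists_Suc: "sum f (index_lists (Suc m)) = (\<Sum>i\<in>I. \<Sum>is\<in>index_lists m. f (i # is))"
proof -
  have "index_lists (Suc m) = (\<lambda>(i, is). i # is) ` (I \<times> index_lists m)"
    by (auto simp: length_Suc_conv image_iff)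
  then have "sum f (index_lists (Suc m)) = sum (f \<circ> (\<lambda>(i, is). i # is)) (I \<times> index_lists m)"
    by (simp only:) (rule sum.reindex, auto simp: inj_on_def)
  then show ?thesis
    by (simp add: sum.cartesian_product case_prod_unfold)
qed

text \<open>Letters are expanded from left to right; basis vectors already substituted accumulate in
  the prefix \<open>us\<close>, over which the induction therefore generalises.\<close>

lemma tensor_cong_word_expand:
  "length us + length w = m \<Longrightarrow> tensor_cong scale m (word (us @ w))
    (\<Sum>is\<in>index_lists (length w). formal_scale (word_coeff coord is w) (word (us @ map e is)))"
proof (induction w arbitrary: us)
  case Nil
  have "index_lists 0 = {[]}" by auto
  then show ?case by simp
next
  case (Cons x w)
  have "tensor_cong scale m (word (us @ [\<Sum>i\<in>I. scale (coord i x) (e i)] @ w))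
      (\<Sum>i\<in>I. formal_scale (coord i x) (word (us @ [e i] @ w)))"
    by (rule tensor_cong_word_sum) (use Cons.prems finite_index in auto)
  also have "tensor_cong scale m \<dots> (\<Sum>i\<in>I. formal_scale (coord i x)
      (\<Sum>is\<in>index_lists (length w). formal_scale (word_coeff coord is w) (word ((us @ [e i]) @ map e is))))"
    using Cons.IH[of "us @ [e i]" for i] Cons.prems
    by (intro tensor_cong_sum tensor_cong_scale) simp
  also have "\<dots> = (\<Sum>is\<in>index_lists (length (x # w)).
      formal_scale (word_coeff coord is (x # w)) (word (us @ map e is)))"
    by (simp add: index_lists_Suc formal.scale_sum_right del: mem_Collect_eq)
  finally show ?case by (simp add: sum_coord)
qed

text \<open>Modulo the relations, basis words span the words of length \<open>m\<close>. The
  relations for \<open>m\<close> do not rewrite words of other lengths, hence the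
  homogeneity.\<close>

lemma tensor_cong_expand:
  assumes "f \<in> homogeneous m"
  shows "tensor_cong scale m f
    (\<Sum>is\<in>index_lists m. formal_scale (coeff coord is f) (word (map e is)))"
proof -
  let ?K = "Poly_Mapping.keys f"
  let ?l = "Poly_Mapping.lookup f"
  have "tensor_cong scale m (\<Sum>w\<in>?K. formal_scale (?l w) (word w))
    (\<Sum>w\<in>?K. formal_scale (?l w)
      (\<Sum>is\<in>index_lists m. formal_scale (word_coeff coord is w) (word (map e is))))"
    using assms tensor_cong_word_expand[of "[]" _ m]
    by (intro tensor_cong_sum tensor_cong_scale) (auto simp: homogeneous_def)
  also have "(\<Sum>w\<in>?K. formal_scale (?l w)
      (\<Sum>is\<in>index_lists m. formal_scale (word_coeff coord is w) (word (map e is)))) =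
    (\<Sum>is\<in>index_lists m. formal_scale (coeff coord is f) (word (map e is)))"
    unfolding coeff_def formal.scale_sum_right formal.scale_sum_left formal.scale_scale
    by (rule sum.swap)
  finally show ?thesis by (simp flip: eq_sum_words)
qed

text \<open>By linearity of \<open>coeff\<close> it suffices to check the generators, where
  \<open>coord\<close> is linear in the letter concerned. Hence coordinates are well defined on
  cosets.\<close>

lemma coeff_relation_space:
  assumes "length is = m" "f \<in> relation_space scale m"
  shows "coeff coord is f = 0"
  using assms(2) unfolding relation_space_def
proof (induction rule: formal.span_induct)
  case base
  show ?case by (auto simp: formal.subspace_def)
next
  case (step f)
  then show ?case
    unfolding multilinear_relations_def
    by (safe) (use assms(1) in \<open>simp_all add: word_coeff_append[simplified] algebra_simps\<close>)
qed

text \<open>One direction is the well-definedness of coordinates, the other the expansion of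
  \<open>f - g\<close> into basis words. Tensor identities thus become scalar identities.\<close>

lemma tensor_eq_iff_coeff:
  assumes "f \<in> homogeneous m" "g \<in> homogeneous m"
  shows "tensor scale m f = tensor scale m g \<longleftrightarrow>
    (\<forall>is. set is \<subseteq> I \<longrightarrow> length is = m \<longrightarrow> coeff coord is f = coeff coord is g)"
proof
  assume "tensor scale m f = tensor scale m g"
  then show "\<forall>is. set is \<subseteq> I \<longrightarrow> length is = m \<longrightarrow> coeff coord is f = coeff coord is g"
    using coeff_relation_space[of _ m "f - g"] by (simp add: tensor_eq_iff)
next
  assume "\<forall>is. set is \<subseteq> I \<longrightarrow> length is = m \<longrightarrow> coeff coord is f = coeff coord is g"
  then have "(\<Sum>is\<in>index_lists m. formal_scale (coeff coord is (f - g)) (word (map e is))) =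
      (0 :: 'v list \<Rightarrow>\<^sub>0 'k)"
    by (intro sum.neutral) simp
  with tensor_cong_expand[OF homogeneous_diff[OF assms]]
  have "tensor_cong scale m (f - g) 0" by simp
  then show "tensor scale m f = tensor scale m g"
    by (simp add: tensor_eq_iff tensor_cong_def)
qed

end


section \<open>Signed sums over permutations and coordinates of wedge products\<close>

definition alt3 :: "('i \<Rightarrow> 'i \<Rightarrow> 'i \<Rightarrow> 'k::comm_ring_1) \<Rightarrow> 'i \<Rightarrow> 'i \<Rightarrow> 'i \<Rightarrow> 'k"
  where "alt3 f x y z = f x y z - f y x z - f x z y - f z y x + f y z x + f z x y"

text \<open>The negative terms of \<open>alt3\<close> come from the transpositions, the positive
  ones from the identity and the 3-cycles.\<close>

lemma sum_sign_permutations_3: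
  fixes g :: "nat \<Rightarrow> nat \<Rightarrow> nat \<Rightarrow> 'k::comm_ring_1"
  shows "(\<Sum>\<sigma> | \<sigma> permutes {..<3}. of_int (sign \<sigma>) * g (\<sigma> 0) (\<sigma> 1) (\<sigma> 2)) =
    alt3 g 0 1 2"
proof -
  have set: "{..<3} = {0, 1, 2::nat}" by auto
  show ?thesis
    unfolding set
    by (simp add: sum_over_permutations_insert alt3_def sign_compose permutation_compose
        permutation_swap_id sign_swap_id sign_id transpose_def algebra_simps flip: id_def)
qed

text \<open>Permutations are grouped by the position that takes the value 0. Moving this 0 to the
  front from position \<open>t\<close> costs \<open>t\<close> adjacent swaps, so the signs
  alternate.\<close>

lemma sum_sign_permutations_4:
  fixes g :: "nat \<Rightarrow> nat \<Rightarrow> nat \<Rightarrow> nat \<Rightarrow> 'k::comm_ring_1"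
  shows "(\<Sum>\<sigma> | \<sigma> permutes {..<4}. of_int (sign \<sigma>) * g (\<sigma> 0) (\<sigma> 1) (\<sigma> 2) (\<sigma> 3)) =
    alt3 (g 0) 1 2 3 - alt3 (\<lambda>x. g x 0) 1 2 3 + alt3 (\<lambda>x y. g x y 0) 1 2 3
      - alt3 (\<lambda>x y z. g x y z 0) 1 2 3"
proof -
  have set: "{..<4} = {0, 1, 2, 3::nat}" by auto
  show ?thesis
    unfolding set
    by (simp add: sum_over_permutations_insert alt3_def sign_compose permutation_compose
        permutation_swap_id sign_swap_id sign_id transpose_def algebra_simps flip: id_def)
qed

text \<open>This is the determinant of the minor of \<open>a\<close> with rows
  \<open>i, j, k\<close> and columns \<open>p, q, s\<close>.\<close>

lemma D_coeff_eq: "D_coeff a i j k p q s = alt3 (\<lambda>x y z. a x p * a y q * a z s) i j k"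
  unfolding D_coeff_def
  by (subst sum_sign_permutations_3[where g = "\<lambda>x y z. a ([i, j, k] ! x) p * a ([i, j, k] ! y) q * a ([i, j, k] ! z) s"])
    (simp add: alt3_def)

text \<open>The coordinate is the determinant of the 4 by 4 matrix of values of \<open>c\<close>;
  the right-hand side is its Laplace expansion along the column of \<open>w\<close>.\<close>

lemma coeff_wedge:
  "coeff c [\<alpha>, \<beta>, \<gamma>, \<delta>] (wedge [w, x, y, z]) =
    c \<alpha> w * alt3 (\<lambda>x y z. c \<beta> x * c \<gamma> y * c \<delta> z) x y z
  - c \<beta> w * alt3 (\<lambda>x y z. c \<alpha> x * c \<gamma> y * c \<delta> z) x y z
  + c \<gamma> w * alt3 (\<lambda>x y z. c \<alpha> x * c \<beta> y * c \<delta> z) x y z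
  - c \<delta> w * alt3 (\<lambda>x y z. c \<alpha> x * c \<beta> y * c \<gamma> z) x y z"
proof -
  let ?vs = "[w, x, y, z]"
  let ?g = "\<lambda>i j k l. c \<alpha> (?vs ! i) * c \<beta> (?vs ! j) * c \<gamma> (?vs ! k) * c \<delta> (?vs ! l)"
  have "[0..<4] = [0, 1, 2, 3::nat]" by (simp add: upt_rec)
  then have "word_coeff c [\<alpha>, \<beta>, \<gamma>, \<delta>] (permute_list \<sigma> ?vs) = ?g (\<sigma> 0) (\<sigma> 1) (\<sigma> 2) (\<sigma> 3)" for \<sigma>
    by (simp add: permute_list_def mult.assoc numeral_2_eq_2 numeral_3_eq_3)
  then have "coeff c [\<alpha>, \<beta>, \<gamma>, \<delta>] (wedge ?vs) =
      (\<Sum>\<sigma> | \<sigma> permutes {..<4}. of_int (sign \<sigma>) * ?g (\<sigma> 0) (\<sigma> 1) (\<sigma> 2) (\<sigma> 3))"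
    unfolding wedge_def by (simp add: lessThan_Suc numeral_eq_Suc)
  also have "\<dots> = alt3 (?g 0) 1 2 3 - alt3 (\<lambda>x. ?g x 0) 1 2 3 + alt3 (\<lambda>x y. ?g x y 0) 1 2 3
      - alt3 (\<lambda>x y z. ?g x y z 0) 1 2 3"
    by (rule sum_sign_permutations_4)
  finally show ?thesis
    by (simp add: alt3_def algebra_simps)
qed

section \<open>Kronecker deltas and alternating functions of three indices\<close>

abbreviation kron :: "'i \<Rightarrow> 'i \<Rightarrow> 'k::zero_neq_one"
  where "kron i j \<equiv> if i = j then 1 else 0"

lemma mult_if_zero:
  fixes b :: "'k::mult_zero"
  shows "b * (if P then c else 0) = (if P then b * c else 0)"
  by simp

text \<open>Over a general commutative ring skew-symmetry does not force vanishing on repeated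
  arguments, so \<open>diag\<close> is a separate assumption. The other repetitions reduce to it by
  swaps.\<close>

locale alternating3 =
  fixes n :: nat and f :: "nat \<Rightarrow> nat \<Rightarrow> nat \<Rightarrow> 'k::comm_ring_1"
  assumes swap_12: "\<lbrakk>i \<in> {1..n}; j \<in> {1..n}; k \<in> {1..n}\<rbrakk> \<Longrightarrow> f j i k = - f i j k"
    and swap_23: "\<lbrakk>i \<in> {1..n}; j \<in> {1..n}; k \<in> {1..n}\<rbrakk> \<Longrightarrow> f i k j = - f i j k"
    and diag: "\<lbrakk>i \<in> {1..n}; k \<in> {1..n}\<rbrakk> \<Longrightarrow> f i i k = 0"
begin

lemma sum_increasing_kron:
  assumes "x \<in> {1..n}" "y \<in> {1..n}" "z \<in> {1..n}"
  shows "(\<Sum>p\<in>{1..n}. \<Sum>q\<in>{p<..n}. \<Sum>s\<in>{q<..n}. f p q s * (kron x p * kron y q * kron z s)) =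
    (if x < y \<and> y < z then f x y z else 0)"
proof -
  have "(\<Sum>p\<in>{1..n}. \<Sum>q\<in>{p<..n}. \<Sum>s\<in>{q<..n}. f p q s * (kron x p * kron y q * kron z s)) =
    (\<Sum>p\<in>{1..n}. \<Sum>q\<in>{p<..n}. if y = q then \<Sum>s\<in>{q<..n}. if z = s then f p q s * kron x p else 0 else 0)"
    by (intro sum.cong refl) (simp add: mult_if_zero)
  also have "\<dots> = (\<Sum>p\<in>{1..n}. if x = p then if p < y \<and> y < z then f p y z else 0 else 0)"
    by (intro sum.cong refl) (use assms in \<open>auto simp: mult_if_zero\<close>)
  finally show ?thesis using assms by simp
qed

text \<open>An alternating function is recovered from its increasing triples, with alternated deltas
  as kernel: for distinct arguments exactly one reordering is increasing and contributes its sign;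
  if two arguments agree, both sides vanish.\<close>

lemma expand_increasing:
  assumes "x \<in> {1..n}" "y \<in> {1..n}" "z \<in> {1..n}"
  shows "(\<Sum>p\<in>{1..n}. \<Sum>q\<in>{p<..n}. \<Sum>s\<in>{q<..n}.
    f p q s * alt3 (\<lambda>p q s. kron x p * kron y q * kron z s) p q s) = f x y z"
proof -
  \<comment> \<open>A determinant equals that of its transpose. Alternating in
    \<open>x, y, z\<close> instead leaves six sums to which \<open>sum_increasing_kron\<close>
    applies.\<close>
  have "alt3 (\<lambda>p q s. kron x p * kron y q * kron z s) p q s =
    (alt3 (\<lambda>x y z. kron x p * kron y q * kron z s) x y z :: 'k)" for p q s
    unfolding alt3_def by (simp add: algebra_simps)
  then have "(\<Sum>p\<in>{1..n}. \<Sum>q\<in>{p<..n}. \<Sum>s\<in>{q<..n}.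
    f p q s * alt3 (\<lambda>p q s. kron x p * kron y q * kron z s) p q s) =
    alt3 (\<lambda>x y z. if x < y \<and> y < z then f x y z else 0) x y z"
    unfolding alt3_def
    by (simp only: distrib_left right_diff_distrib sum.distrib sum_subtractf
        sum_increasing_kron assms)
  also have "\<dots> = f x y z"
    using assms swap_12[of x y z] swap_12[of x z y] swap_12[of y z x] swap_23[of x y z] swap_23[of y x z]
      swap_23[of z x y] diag[of x y] diag[of x z] diag[of y x] diag[of y z]
    by (cases x y rule: linorder_cases; cases y z rule: linorder_cases; cases x z rule: linorder_cases)
      (auto simp: alt3_def)
  finally show ?thesis .
qed

text \<open>Expanding \<open>f\<close> by \<open>expand_increasing\<close> and exchanging the sums
  pairs \<open>g\<close> with the alternated deltas, which antisymmetrizes \<open>g\<close>.\<close>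

lemma sum_eq_sum_increasing:
  "(\<Sum>x\<in>{1..n}. \<Sum>y\<in>{1..n}. \<Sum>z\<in>{1..n}. g x y z * f x y z) =
    (\<Sum>p\<in>{1..n}. \<Sum>q\<in>{p<..n}. \<Sum>s\<in>{q<..n}. alt3 g p q s * f p q s)"
proof -
  have kron: "(\<Sum>x\<in>{1..n}. \<Sum>y\<in>{1..n}. \<Sum>z\<in>{1..n}. g x y z * (kron x p * kron y q * kron z s)) = g p q s"
    if "p \<in> {1..n}" "q \<in> {1..n}" "s \<in> {1..n}" for p q s
    using that by (simp add: mult_if_zero)
  have "(\<Sum>x\<in>{1..n}. \<Sum>y\<in>{1..n}. \<Sum>z\<in>{1..n}. g x y z * f x y z) =
    (\<Sum>x\<in>{1..n}. \<Sum>y\<in>{1..n}. \<Sum>z\<in>{1..n}. \<Sum>p\<in>{1..n}. \<Sum>q\<in>{p<..n}. \<Sum>s\<in>{q<..n}.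
      g x y z * (f p q s * alt3 (\<lambda>p q s. kron x p * kron y q * kron z s) p q s))"
    by (intro sum.cong refl) (simp only: expand_increasing flip: sum_distrib_left)
  also have "\<dots> = (\<Sum>p\<in>{1..n}. \<Sum>q\<in>{p<..n}. \<Sum>s\<in>{q<..n}. \<Sum>x\<in>{1..n}. \<Sum>y\<in>{1..n}. \<Sum>z\<in>{1..n}.
      g x y z * (f p q s * alt3 (\<lambda>p q s. kron x p * kron y q * kron z s) p q s))"
  proof -
    \<comment> \<open>The ranges of \<open>q\<close> and \<open>s\<close> depend on earlier indices.
      Gathering the triples into one set allows each outer sum to be exchanged with them at
      once.\<close>
    let ?S = "SIGMA p:{1..n}. SIGMA q:{p<..n}. {q<..n}"
    have "(\<Sum>p\<in>{1..n}. \<Sum>q\<in>{p<..n}. \<Sum>s\<in>{q<..n}. h p q s) = (\<Sum>(p, q, s)\<in>?S. h p q s)"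
      for h :: "nat \<Rightarrow> nat \<Rightarrow> nat \<Rightarrow> 'k"
      by (simp add: sum.Sigma)
    then show ?thesis
      by (simp only: sum.swap[of _ ?S "{1..n}"] case_prod_unfold)
  qed
  also have "\<dots> = (\<Sum>p\<in>{1..n}. \<Sum>q\<in>{p<..n}. \<Sum>s\<in>{q<..n}. alt3 g p q s * f p q s)"
  proof (intro sum.cong refl)
    fix p q s assume "p \<in> {1..n}" "q \<in> {p<..n}" "s \<in> {q<..n}"
    then have mem: "p \<in> {1..n}" "q \<in> {1..n}" "s \<in> {1..n}" by auto
    have "(\<Sum>x\<in>{1..n}. \<Sum>y\<in>{1..n}. \<Sum>z\<in>{1..n}.
        g x y z * (f p q s * alt3 (\<lambda>p q s. kron x p * kron y q * kron z s) p q s)) =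
      f p q s * (\<Sum>x\<in>{1..n}. \<Sum>y\<in>{1..n}. \<Sum>z\<in>{1..n}.
        g x y z * alt3 (\<lambda>p q s. kron x p * kron y q * kron z s) p q s)"
      by (simp only: sum_distrib_left mult.left_commute)
    also have "(\<Sum>x\<in>{1..n}. \<Sum>y\<in>{1..n}. \<Sum>z\<in>{1..n}.
        g x y z * alt3 (\<lambda>p q s. kron x p * kron y q * kron z s) p q s) = alt3 g p q s"
      unfolding alt3_def
      by (simp only: distrib_left right_diff_distrib sum.distrib sum_subtractf kron mem)
    finally show "(\<Sum>x\<in>{1..n}. \<Sum>y\<in>{1..n}. \<Sum>z\<in>{1..n}.
        g x y z * (f p q s * alt3 (\<lambda>p q s. kron x p * kron y q * kron z s) p q s)) =
      alt3 g p q s * f p q s"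
      by (simp only: mult.commute)
  qed
  finally show ?thesis .
qed

end


section \<open>The bracket and \<open>[[r,r,r]]\<close> in coordinates\<close>

lemma sum_product_3:
  fixes f g h :: "'i \<Rightarrow> 't \<Rightarrow> 'k::comm_ring_1"
  shows "(\<Sum>t\<in>U. \<Sum>u\<in>U. \<Sum>v\<in>U. \<Sum>i\<in>J. \<Sum>j\<in>J. \<Sum>k\<in>J. f i t * g j u * h k v * c i j k) =
    (\<Sum>i\<in>J. \<Sum>j\<in>J. \<Sum>k\<in>J. (\<Sum>t\<in>U. f i t) * (\<Sum>u\<in>U. g j u) * (\<Sum>v\<in>U. h k v) * c i j k)"
proof -
  have "(\<Sum>t\<in>U. f i t) * (\<Sum>u\<in>U. g j u) * (\<Sum>v\<in>U. h k v) * c i j k =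
      (\<Sum>t\<in>U. \<Sum>u\<in>U. \<Sum>v\<in>U. f i t * g j u * h k v * c i j k)" for i j k
    by (simp only: sum_distrib_left[symmetric] sum_distrib_right[symmetric])
  moreover have "(\<Sum>i\<in>J. \<Sum>j\<in>J. \<Sum>k\<in>J. F i j k) = (\<Sum>(i, j, k)\<in>J \<times> J \<times> J. F i j k)"
    for F :: "'i \<Rightarrow> 'i \<Rightarrow> 'i \<Rightarrow> 'k"
    by (simp add: sum.cartesian_product)
  ultimately show ?thesis
    by (simp only: sum.swap[of _ "J \<times> J \<times> J" U] case_prod_unfold)
qed

context three_lie_algebra
begin

lemma br_sum_1: "br (\<Sum>i\<in>A. scale (b i) (f i)) y z = (\<Sum>i\<in>A. scale (b i) (br (f i) y z))"
proof -
  interpret L: Vector_Spaces.linear scale scale "\<lambda>x. br x y z" by (rule linear_1)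
  show ?thesis by (simp add: L.sum L.scale)
qed

lemma br_sum_2: "br x (\<Sum>i\<in>A. scale (b i) (f i)) z = (\<Sum>i\<in>A. scale (b i) (br x (f i) z))"
proof -
  interpret L: Vector_Spaces.linear scale scale "\<lambda>y. br x y z" by (rule linear_2)
  show ?thesis by (simp add: L.sum L.scale)
qed

lemma br_sum_3: "br x y (\<Sum>i\<in>A. scale (b i) (f i)) = (\<Sum>i\<in>A. scale (b i) (br x y (f i)))"
proof -
  interpret L: Vector_Spaces.linear scale scale "\<lambda>z. br x y z" by (rule linear_3)
  show ?thesis by (simp add: L.sum L.scale)
qed

text \<open>Skew-symmetry alone says that twice the bracket vanishes; this supplies
  \<open>diag\<close> for the structure constants.\<close>

lemma br_same:
  assumes "(2::'k) \<noteq> 0"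
  shows "br x x z = 0"
proof -
  have "br x x z + br x x z = 0"
    using skew_12[of x x z] by (simp add: eq_neg_iff_add_eq_0)
  then have "scale 2 (br x x z) = 0"
    using scale_left_distrib[of 1 1 "br x x z"] by simp
  with assms show ?thesis by simp
qed

end

text \<open>
  Otherwise the simplifier turns \<open>{1..n}\<close> into \<open>{Suc 0..n}\<close>, on which the simplification rules
  of the instantiated locales do not fire.
\<close>

declare One_nat_def [simp del]

locale three_lie_basis = three_lie_algebra scale br + indexed_basis scale "{1..n}" e
  for scale :: "'k::field \<Rightarrow> 'v::ab_group_add \<Rightarrow> 'v" and br n and e :: "nat \<Rightarrow> 'v" +
  assumes two_nonzero: "(2::'k) \<noteq> 0"
begin

text \<open>The constants \<open>T\<close> of the theorem are constrained only on
  \<open>{1..n}\<close>; these are read off from the bracket and inherit its symmetries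
  directly.\<close>

definition structure_const :: "nat \<Rightarrow> nat \<Rightarrow> nat \<Rightarrow> nat \<Rightarrow> 'k"
  where "structure_const i j k l = coord l (br (e i) (e j) (e k))"

lemma coord_br:
  "coord l (br x y z) = (\<Sum>i\<in>{1..n}. \<Sum>j\<in>{1..n}. \<Sum>k\<in>{1..n}.
    coord i x * coord j y * coord k z * structure_const i j k l)"
proof -
  have "br x y z = (\<Sum>i\<in>{1..n}. scale (coord i x) (\<Sum>j\<in>{1..n}. scale (coord j y)
      (\<Sum>k\<in>{1..n}. scale (coord k z) (br (e i) (e j) (e k)))))"
    by (simp only: br_sum_1[symmetric] br_sum_2[symmetric] br_sum_3[symmetric] sum_coord)
  then show ?thesis
    by (simp add: structure_const_def sum_distrib_left mult.assoc)
qed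

lemma alternating_structure_const: "alternating3 n (\<lambda>i j k. structure_const i j k l)"
proof
  fix i j k
  show "structure_const j i k l = - structure_const i j k l"
    unfolding structure_const_def by (subst skew_12) simp
  show "structure_const i k j l = - structure_const i j k l"
    unfolding structure_const_def by (subst skew_23) simp
  show "structure_const i i k l = 0"
    by (simp add: structure_const_def br_same two_nonzero)
qed

lemma coeff_sum_of_pairs:
  "coeff coord [i, j] (sum_of_pairs ps) =
    (\<Sum>t<length ps. coord i (fst (ps ! t)) * coord j (snd (ps ! t)))"
  by (simp add: sum_of_pairs_def)

text \<open>For fixed structure constants the three sums over \<open>ps\<close> factor by
  \<open>sum_product_3\<close>, each factor being an entry of \<open>A\<close>. The summed index
  comes first in \<open>A\<close> when \<open>x\<close> is in the bracket and second when
  \<open>y\<close> is. Hence \<open>ps\<close> enters only through \<open>A\<close>.\<close>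

lemma coeff_rrr_of_pairs:
  assumes A: "\<And>i j. A i j = coeff coord [i, j] (sum_of_pairs ps)"
  shows "coeff coord [\<alpha>, \<beta>, \<gamma>, \<delta>] (rrr_of_pairs br ps) =
    (\<Sum>i\<in>{1..n}. \<Sum>j\<in>{1..n}. \<Sum>k\<in>{1..n}. A i \<beta> * A j \<gamma> * A k \<delta> * structure_const i j k \<alpha>) +
    (\<Sum>i\<in>{1..n}. \<Sum>j\<in>{1..n}. \<Sum>k\<in>{1..n}. A \<alpha> i * A j \<gamma> * A k \<delta> * structure_const i j k \<beta>) +
    (\<Sum>i\<in>{1..n}. \<Sum>j\<in>{1..n}. \<Sum>k\<in>{1..n}. A \<alpha> i * A \<beta> j * A k \<delta> * structure_const i j k \<gamma>) +
    (\<Sum>i\<in>{1..n}. \<Sum>j\<in>{1..n}. \<Sum>k\<in>{1..n}. A \<alpha> i * A \<beta> j * A \<gamma> k * structure_const i j k \<delta>)"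
  unfolding A coeff_sum_of_pairs sum_product_3[symmetric]
  by (simp add: rrr_of_pairs_def Let_def sum.distrib coord_br sum_distrib_left sum_distrib_right mult_ac)

context
  fixes a :: "nat \<Rightarrow> nat \<Rightarrow> 'k"
begin

text \<open>The coordinate of \<open>e\<^sub>l \<otimes> e\<^sub>p \<otimes> e\<^sub>q \<otimes> e\<^sub>s\<close> in the first of the four sums that make up \<open>[[r,r,r]]\<close>.\<close>

definition contraction :: "nat \<Rightarrow> nat \<Rightarrow> nat \<Rightarrow> nat \<Rightarrow> 'k"
  where "contraction l p q s =
    (\<Sum>i\<in>{1..n}. \<Sum>j\<in>{1..n}. \<Sum>k\<in>{1..n}. a i p * a j q * a k s * structure_const i j k l)"

lemma contraction_eq:
  "contraction l p q s =
    (\<Sum>i\<in>{1..n}. \<Sum>j\<in>{i<..n}. \<Sum>k\<in>{j<..n}. D_coeff a i j k p q s * structure_const i j k l)"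
  unfolding contraction_def D_coeff_eq
  by (rule alternating3.sum_eq_sum_increasing[OF alternating_structure_const])

text \<open>The form in \<open>contraction_eq\<close> depends on \<open>p, q, s\<close> only through
  the columns of a determinant, which changes sign under swaps and vanishes for equal
  columns.\<close>

lemma alternating_contraction: "alternating3 n (contraction l)"
proof
  fix p q s
  show "contraction l q p s = - contraction l p q s" "contraction l p s q = - contraction l p q s"
    unfolding contraction_eq sum_negf[symmetric]
    by (intro sum.cong refl; simp add: D_coeff_eq alt3_def algebra_simps)+
  show "contraction l p p s = 0"
    unfolding contraction_eq
    by (intro sum.neutral ballI) (simp add: D_coeff_eq alt3_def algebra_simps)
qed

lemma coeff_sum_wedge:
  assumes "\<alpha> \<in> {1..n}" "\<beta> \<in> {1..n}" "\<gamma> \<in> {1..n}" "\<delta> \<in> {1..n}"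
  shows "coeff coord [\<alpha>, \<beta>, \<gamma>, \<delta>]
      (\<Sum>p\<in>{1..n}. \<Sum>q\<in>{p<..n}. \<Sum>s\<in>{q<..n}.
       \<Sum>i\<in>{1..n}. \<Sum>j\<in>{i<..n}. \<Sum>k\<in>{j<..n}. \<Sum>l\<in>{1..n}.
         formal_scale (D_coeff a i j k p q s * structure_const i j k l) (wedge [e l, e p, e q, e s])) =
    contraction \<alpha> \<beta> \<gamma> \<delta> - contraction \<beta> \<alpha> \<gamma> \<delta> + contraction \<gamma> \<alpha> \<beta> \<delta> - contraction \<delta> \<alpha> \<beta> \<gamma>"
proof -
  let ?W = "\<lambda>x y z. alt3 (\<lambda>p q s. kron x p * kron y q * kron z s)"
  have wedge: "coeff coord [\<alpha>, \<beta>, \<gamma>, \<delta>] (wedge [e l, e p, e q, e s]) =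
      kron \<alpha> l * ?W \<beta> \<gamma> \<delta> p q s - kron \<beta> l * ?W \<alpha> \<gamma> \<delta> p q s
      + kron \<gamma> l * ?W \<alpha> \<beta> \<delta> p q s - kron \<delta> l * ?W \<alpha> \<beta> \<gamma> p q s"
    if "l \<in> {1..n}" "p \<in> {1..n}" "q \<in> {1..n}" "s \<in> {1..n}" for l p q s
    unfolding coeff_wedge alt3_def by (simp only: coord_basis assms that)
  \<comment> \<open>In each Laplace term a delta fixes \<open>l\<close>, and the remaining sum over
    increasing \<open>i, j, k\<close> is \<open>contraction\<close> in the form of
    \<open>contraction_eq\<close>.\<close>
  have inner: "(\<Sum>i\<in>{1..n}. \<Sum>j\<in>{i<..n}. \<Sum>k\<in>{j<..n}. \<Sum>l\<in>{1..n}.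
        D_coeff a i j k p q s * structure_const i j k l * coeff coord [\<alpha>, \<beta>, \<gamma>, \<delta>] (wedge [e l, e p, e q, e s])) =
      contraction \<alpha> p q s * ?W \<beta> \<gamma> \<delta> p q s - contraction \<beta> p q s * ?W \<alpha> \<gamma> \<delta> p q s
      + contraction \<gamma> p q s * ?W \<alpha> \<beta> \<delta> p q s - contraction \<delta> p q s * ?W \<alpha> \<beta> \<gamma> p q s"
    if "p \<in> {1..n}" "q \<in> {p<..n}" "s \<in> {q<..n}" for p q s
  proof -
    have mem: "q \<in> {1..n}" "s \<in> {1..n}" using that by auto
    have kron: "(\<Sum>l\<in>{1..n}. g l * (kron x l * w)) = g x * w" if "x \<in> {1..n}" for x w and g :: "nat \<Rightarrow> 'k"
    proof -
      have "(\<Sum>l\<in>{1..n}. g l * (kron x l * w)) = (\<Sum>l\<in>{1..n}. if x = l then g l * w else 0)"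
        by (rule sum.cong) auto
      then show ?thesis using that by simp
    qed
    have "(\<Sum>l\<in>{1..n}. D_coeff a i j k p q s * structure_const i j k l * coeff coord [\<alpha>, \<beta>, \<gamma>, \<delta>] (wedge [e l, e p, e q, e s])) =
      D_coeff a i j k p q s * structure_const i j k \<alpha> * ?W \<beta> \<gamma> \<delta> p q s
      - D_coeff a i j k p q s * structure_const i j k \<beta> * ?W \<alpha> \<gamma> \<delta> p q s
      + D_coeff a i j k p q s * structure_const i j k \<gamma> * ?W \<alpha> \<beta> \<delta> p q s
      - D_coeff a i j k p q s * structure_const i j k \<delta> * ?W \<alpha> \<beta> \<gamma> p q s" for i j k
      by (simp only: wedge that mem distrib_left right_diff_distrib sum.distrib sum_subtractf kron assms cong: sum.cong)
    then show ?thesis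
      by (simp only: sum.distrib sum_subtractf contraction_eq sum_distrib_right)
  qed
  have "coeff coord [\<alpha>, \<beta>, \<gamma>, \<delta>]
      (\<Sum>p\<in>{1..n}. \<Sum>q\<in>{p<..n}. \<Sum>s\<in>{q<..n}.
       \<Sum>i\<in>{1..n}. \<Sum>j\<in>{i<..n}. \<Sum>k\<in>{j<..n}. \<Sum>l\<in>{1..n}.
         formal_scale (D_coeff a i j k p q s * structure_const i j k l) (wedge [e l, e p, e q, e s])) =
     (\<Sum>p\<in>{1..n}. \<Sum>q\<in>{p<..n}. \<Sum>s\<in>{q<..n}.
      contraction \<alpha> p q s * ?W \<beta> \<gamma> \<delta> p q s - contraction \<beta> p q s * ?W \<alpha> \<gamma> \<delta> p q s
      + contraction \<gamma> p q s * ?W \<alpha> \<beta> \<delta> p q s - contraction \<delta> p q s * ?W \<alpha> \<beta> \<gamma> p q s)"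
    unfolding coeff_sum coeff_formal_scale by (intro sum.cong refl inner)
  \<comment> \<open>Each of the four sums over increasing \<open>p, q, s\<close> is an instance of
    \<open>expand_increasing\<close> for the alternating function
    \<open>contraction l\<close>.\<close>
  also have "\<dots> = contraction \<alpha> \<beta> \<gamma> \<delta> - contraction \<beta> \<alpha> \<gamma> \<delta> + contraction \<gamma> \<alpha> \<beta> \<delta> - contraction \<delta> \<alpha> \<beta> \<gamma>"
    by (simp only: sum.distrib sum_subtractf assms
        alternating3.expand_increasing[OF alternating_contraction])
  finally show ?thesis .
qed

lemma coeff_rrr_of_pairs_skew:
  assumes mem: "\<alpha> \<in> {1..n}" "\<beta> \<in> {1..n}" "\<gamma> \<in> {1..n}" "\<delta> \<in> {1..n}"
    and skew: "\<And>i j. i \<in> {1..n} \<Longrightarrow> j \<in> {1..n} \<Longrightarrow> a i j = - a j i"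
    and a: "\<And>i j. i \<in> {1..n} \<Longrightarrow> j \<in> {1..n} \<Longrightarrow> coeff coord [i, j] (sum_of_pairs ps) = a i j"
  shows "coeff coord [\<alpha>, \<beta>, \<gamma>, \<delta>] (rrr_of_pairs br ps) =
    contraction \<alpha> \<beta> \<gamma> \<delta> - contraction \<beta> \<alpha> \<gamma> \<delta> + contraction \<gamma> \<alpha> \<beta> \<delta> - contraction \<delta> \<alpha> \<beta> \<gamma>"
proof -
  \<comment> \<open>Compared with \<open>contraction\<close>, the last three sums contain one, two
    and three transposed entries of \<open>a\<close>, which gives the signs -, + and -.\<close>
  note s = skew[OF mem(1)] skew[OF mem(2)] skew[OF mem(3)]
  have 1: "(\<Sum>i\<in>{1..n}. \<Sum>j\<in>{1..n}. \<Sum>k\<in>{1..n}. a \<alpha> i * a j \<gamma> * a k \<delta> * structure_const i j k \<beta>) =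
      - contraction \<beta> \<alpha> \<gamma> \<delta>"
    unfolding contraction_def sum_negf[symmetric] by (intro sum.cong refl) (simp add: s)
  have 2: "(\<Sum>i\<in>{1..n}. \<Sum>j\<in>{1..n}. \<Sum>k\<in>{1..n}. a \<alpha> i * a \<beta> j * a k \<delta> * structure_const i j k \<gamma>) =
      contraction \<gamma> \<alpha> \<beta> \<delta>"
    unfolding contraction_def by (intro sum.cong refl) (simp add: s)
  have 3: "(\<Sum>i\<in>{1..n}. \<Sum>j\<in>{1..n}. \<Sum>k\<in>{1..n}. a \<alpha> i * a \<beta> j * a \<gamma> k * structure_const i j k \<delta>) =
      - contraction \<delta> \<alpha> \<beta> \<gamma>"
    unfolding contraction_def sum_negf[symmetric] by (intro sum.cong refl) (simp add: s)
  show ?thesis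
    unfolding coeff_rrr_of_pairs[OF refl]
    by (simp only: a mem 1 2 3 contraction_def[symmetric] diff_conv_add_uminus cong: sum.cong)
qed

end

end

section \<open>From coordinates back to tensors\<close>

lemma homogeneous_sum_of_pairs: "sum_of_pairs ps \<in> homogeneous 2"
  unfolding sum_of_pairs_def by (intro homogeneous_sum homogeneous_word) simp

lemma homogeneous_rrr_of_pairs: "rrr_of_pairs br ps \<in> homogeneous 4"
  unfolding rrr_of_pairs_def Let_def
  by (intro homogeneous_sum homogeneous_add homogeneous_word) simp_all

theorem theorem3p1:
  fixes scale :: "'k::field \<Rightarrow> 'v::ab_group_add \<Rightarrow> 'v"
    and br :: "'v \<Rightarrow> 'v \<Rightarrow> 'v \<Rightarrow> 'v"
    and n :: nat
    and e :: "nat \<Rightarrow> 'v"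
    and T :: "nat \<Rightarrow> nat \<Rightarrow> nat \<Rightarrow> nat \<Rightarrow> 'k"
    and a :: "nat \<Rightarrow> nat \<Rightarrow> 'k"
    and r :: "('v list \<Rightarrow>\<^sub>0 'k) set"
  assumes char: "CHAR('k) \<noteq> 2"
    and lie: "three_lie_algebra scale br"
    and basis_inj: "inj_on e {1..n}"
    and basis_indep: "\<not> module.dependent scale (e ` {1..n})"
    and basis_span: "module.span scale (e ` {1..n}) = UNIV"
    and structure_constants: "\<And>i j k. i \<in> {1..n} \<Longrightarrow> j \<in> {1..n} \<Longrightarrow> k \<in> {1..n} \<Longrightarrow>
      br (e i) (e j) (e k) = (\<Sum>m\<in>{1..n}. scale (T i j k m) (e m))"
    and r: "r = tensor scale 2 (\<Sum>i\<in>{1..n}. \<Sum>j\<in>{1..n}. formal_scale (a i j) (word [e i, e j]))"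
    and skew: "\<And>i j. i \<in> {1..n} \<Longrightarrow> j \<in> {1..n} \<Longrightarrow> a i j = - a j i"
  shows "rrr scale br r = tensor scale 4
    (\<Sum>p\<in>{1..n}. \<Sum>q\<in>{p<..n}. \<Sum>s\<in>{q<..n}.
     \<Sum>i\<in>{1..n}. \<Sum>j\<in>{i<..n}. \<Sum>k\<in>{j<..n}. \<Sum>l\<in>{1..n}.
       formal_scale (D_coeff a i j k p q s * T i j k l) (wedge [e l, e p, e q, e s]))"
proof -
  \<comment> \<open>If 2 were 0, the characteristic would divide 2. It is then not 0, and in a field
    it is not 1, so it would be 2.\<close>
  have "(2::'k) \<noteq> 0"
  proof
    assume "(2::'k) = 0"
    then have "of_nat 2 = (0::'k)" by simp
    then have "CHAR('k) dvd 2" by (simp only: of_nat_eq_0_iff_char_dvd)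
    then have "CHAR('k) \<le> 2" "CHAR('k) \<noteq> 0" by (auto dest: dvd_imp_le intro!: gr0I)
    then have "CHAR('k) = 1 \<or> CHAR('k) = 2" by linarith
    with char show False by (simp add: One_nat_def)
  qed
  interpret three_lie_algebra scale br by (rule lie)
  interpret three_lie_basis scale br n e
    by unfold_locales
      (use basis_inj basis_indep basis_span \<open>(2::'k) \<noteq> 0\<close> in auto)
  let ?r = "\<Sum>i\<in>{1..n}. \<Sum>j\<in>{1..n}. formal_scale (a i j) (word [e i, e j])"
  let ?rhs = "\<Sum>p\<in>{1..n}. \<Sum>q\<in>{p<..n}. \<Sum>s\<in>{q<..n}.
     \<Sum>i\<in>{1..n}. \<Sum>j\<in>{i<..n}. \<Sum>k\<in>{j<..n}. \<Sum>l\<in>{1..n}.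
       formal_scale (D_coeff a i j k p q s * T i j k l) (wedge [e l, e p, e q, e s])"
  have T: "T i j k l = structure_const i j k l"
    if "i \<in> {1..n}" "j \<in> {1..n}" "k \<in> {1..n}" "l \<in> {1..n}" for i j k l
    using that by (simp add: structure_const_def structure_constants coord_basis mult_if_zero del: atLeastAtMost_iff)
  have rhs: "?rhs = (\<Sum>p\<in>{1..n}. \<Sum>q\<in>{p<..n}. \<Sum>s\<in>{q<..n}.
     \<Sum>i\<in>{1..n}. \<Sum>j\<in>{i<..n}. \<Sum>k\<in>{j<..n}. \<Sum>l\<in>{1..n}.
       formal_scale (D_coeff a i j k p q s * structure_const i j k l) (wedge [e l, e p, e q, e s]))"
    by (intro sum.cong refl arg_cong2[where f = formal_scale] arg_cong2[where f = "(*)"] T) auto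
  have coeff_r: "coeff coord [i, j] ?r = a i j" if "i \<in> {1..n}" "j \<in> {1..n}" for i j
    using that by (simp add: coord_basis mult_if_zero del: atLeastAtMost_iff cong: sum.cong)
  have r_homogeneous: "?r \<in> homogeneous 2"
    by (intro homogeneous_sum homogeneous_formal_scale homogeneous_word) simp
  \<comment> \<open>This serves twice: it reads the matrix \<open>a\<close> off an arbitrary
    representation of \<open>r\<close>, and it verifies the explicit representation constructed
    below.\<close>
  have represents_iff: "tensor scale 2 (sum_of_pairs ps) = r \<longleftrightarrow>
      (\<forall>i\<in>{1..n}. \<forall>j\<in>{1..n}. coeff coord [i, j] (sum_of_pairs ps) = a i j)" for ps
  proof -
    have "tensor scale 2 (sum_of_pairs ps) = r \<longleftrightarrow> (\<forall>is. set is \<subseteq> {1..n} \<longrightarrow> length is = 2 \<longrightarrow>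
        coeff coord is (sum_of_pairs ps) = coeff coord is ?r)"
      unfolding r by (rule tensor_eq_iff_coeff[OF homogeneous_sum_of_pairs r_homogeneous])
    also have "\<dots> \<longleftrightarrow> (\<forall>i\<in>{1..n}. \<forall>j\<in>{1..n}. coeff coord [i, j] (sum_of_pairs ps) = coeff coord [i, j] ?r)"
      by (simp only: numeral_2_eq_2 length_Suc_conv length_0_conv) (fastforce simp del: coeff_sum)
    finally show ?thesis by (simp only: coeff_r cong: ball_cong)
  qed
  \<comment> \<open>All cosets in the union that defines \<open>rrr\<close> coincide with the
    claimed one.\<close>
  have eq: "tensor scale 4 (rrr_of_pairs br ps) = tensor scale 4 ?rhs"
    if "tensor scale 2 (sum_of_pairs ps) = r" for ps
  proof -
    have "coeff coord is (rrr_of_pairs br ps) = coeff coord is ?rhs"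
      if "set is \<subseteq> {1..n}" "length is = 4" for "is"
    proof -
      obtain \<alpha> \<beta> \<gamma> \<delta> where "is": "is = [\<alpha>, \<beta>, \<gamma>, \<delta>]"
        using \<open>length is = 4\<close> by (auto simp: numeral_eq_Suc length_Suc_conv)
      with \<open>set is \<subseteq> {1..n}\<close> have mem: "\<alpha> \<in> {1..n}" "\<beta> \<in> {1..n}" "\<gamma> \<in> {1..n}" "\<delta> \<in> {1..n}" by auto
      have a: "coeff coord [i, j] (sum_of_pairs ps) = a i j" if "i \<in> {1..n}" "j \<in> {1..n}" for i j
        using represents_iff \<open>tensor scale 2 (sum_of_pairs ps) = r\<close> that by blast
      show ?thesis
        unfolding "is" rhs coeff_sum_wedge[OF mem] by (rule coeff_rrr_of_pairs_skew[OF mem skew a])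
    qed
    moreover have "?rhs \<in> homogeneous 4"
      by (intro homogeneous_sum homogeneous_formal_scale homogeneous_wedge) simp
    ultimately show ?thesis
      by (subst tensor_eq_iff_coeff[OF homogeneous_rrr_of_pairs]) blast+
  qed
  \<comment> \<open>The union must also be nonempty, so a representation of \<open>r\<close> is
    exhibited. Sums of pairs carry no scalars; the coefficients \<open>a i j\<close> are absorbed
    into the first components.\<close>
  obtain ps where "tensor scale 2 (sum_of_pairs ps) = r"
  proof
    let ?f = "\<lambda>(i, j). (scale (a i j) (e i), e j)"
    \<comment> \<open>The upper bound of the list interval is exclusive, so \<open>Suc n\<close>
      gives the indices from 1 to \<open>n\<close>.\<close>
    let ?is = "List.product [1..<Suc n] [1..<Suc n]"
    let ?ps = "map ?f ?is"
    have "coeff coord [k, l] (sum_of_pairs ?ps) = a k l" if "k \<in> {1..n}" "l \<in> {1..n}" for k l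
    proof -
      let ?g = "\<lambda>x. coord k (fst x) * coord l (snd x)"
      have "coeff coord [k, l] (sum_of_pairs ?ps) = sum_list (map ?g ?ps)"
        by (simp only: coeff_sum_of_pairs sum_list_sum_nth) (simp add: atLeast0LessThan)
      \<comment> \<open>The sum is taken over index pairs, which are distinct, whereas the pairs of
        vectors can coincide when entries of \<open>a\<close> vanish.\<close>
      also have "\<dots> = (\<Sum>x\<in>set ?is. ?g (?f x))"
        by (simp only: map_map sum_list_distinct_conv_sum_set distinct_product distinct_upt o_def)
      also have "set ?is = {1..n} \<times> {1..n}" by auto
      also have "(\<Sum>x\<in>{1..n} \<times> {1..n}. ?g (?f x)) = (\<Sum>i\<in>{1..n}. \<Sum>j\<in>{1..n}. ?g (?f (i, j)))"
        by (simp add: sum.cartesian_product case_prod_unfold)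
      also have "\<dots> = a k l"
        using that by (simp add: coord_basis mult_if_zero del: atLeastAtMost_iff cong: sum.cong)
      finally show ?thesis .
    qed
    then show "tensor scale 2 (sum_of_pairs ?ps) = r"
      using represents_iff by blast
  qed
  with eq show ?thesis
    unfolding rrr_def by blast
qed

end
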